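(* Let $T^\ast:\mathbb{Z}\to\{a,b,c,d\}$ be a palindrome-free Thue's sequence. If $W=(v_1,\dots,v_k,v_{k+1},\dots,v_{2k})$ is a repetitive lazy walk in $T^\ast$, then $v_i=v_{k+i}$ for all $1\le i\le k$; that is, $W$ is composed of two identical lazy walks.
   Context: A sequence $T^\ast:\mathbb{Z}\to\{a,b,c,d\}$ is a palindrome-free Thue's sequence if (i) it contains no repetition: there are no $i\in\mathbb{Z}$, $k\ge1$ with $T^\ast(i+j)=T^\ast(i+k+j)$ for all $0\le j<k$; and (ii) it contains no palindrome: there is no block $T^\ast(i),T^\ast(i+1),\dots,T^\ast(i+m)$ with $m\ge1$ which equals its reversal. The sequence is viewed as a coloring of the two-way infinite path with vertex set $\mathbb{Z}$ (where $i$ and $i+1$ are adjacent). A lazy walk in it is a sequence of integers $v_1,\dots,v_r$ with $v_{j+1}-v_j\in\{-1,0,1\}$ for all $j$. A lazy walk $(v_1,\dots,v_{2k})$ is repetitive if $T^\ast(v_i)=T^\ast(v_{k+i})$ for all $1\le i\le k$. *)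

theory Defs
  imports Main
begin

datatype letter = La | Lb | Lc | Ld

definition has_repetition :: "(int \<Rightarrow> letter) \<Rightarrow> bool" where
  "has_repetition T \<longleftrightarrow>
     (\<exists>i. \<exists>k::nat. k \<ge> 1 \<and> (\<forall>j<k. T (i + int j) = T (i + int k + int j)))"

text \<open>\<open>block T i m\<close> has \<open>m + 1\<close> letters: \<open>T i, T (i + 1), \<dots>, T (i + m)\<close>.\<close>

definition block :: "(int \<Rightarrow> letter) \<Rightarrow> int \<Rightarrow> nat \<Rightarrow> letter list" where
  "block T i m = map (\<lambda>j. T (i + int j)) [0..<Suc m]"

definition has_palindrome :: "(int \<Rightarrow> letter) \<Rightarrow> bool" where
  "has_palindrome T \<longleftrightarrow> (\<exists>i. \<exists>m\<ge>1. rev (block T i m) = block T i m)"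

definition palindrome_free_thue :: "(int \<Rightarrow> letter) \<Rightarrow> bool" where
  "palindrome_free_thue T \<longleftrightarrow> \<not> has_repetition T \<and> \<not> has_palindrome T"

text \<open>
  Walks are lists of vertices of the two-way infinite path on the integers. List positions
  start at 0, so \<open>W ! i\<close> is the vertex usually written \<open>v\<^sub>i\<^sub>+\<^sub>1\<close>.
\<close>

definition lazy_walk :: "int list \<Rightarrow> bool" where
  "lazy_walk W \<longleftrightarrow> (\<forall>j. Suc j < length W \<longrightarrow> W ! Suc j - W ! j \<in> {-1, 0, 1})"

definition repetitive :: "(int \<Rightarrow> letter) \<Rightarrow> nat \<Rightarrow> int list \<Rightarrow> bool" where
  "repetitive T k W \<longleftrightarrow> length W = 2 * k \<and> (\<forall>i<k. T (W ! i) = T (W ! (k + i)))"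

end

theory Submission
  imports Defs
begin

text \<open>
  Since the sequence has no palindromes of length two or three, any three consecutive letters are
  distinct, so the letters read along a lazy walk determine the walk up to its start and a
  direction. Hence the second half of a repetitive lazy walk is a translate or a reflection of
  the first half, which visits a whole interval of vertices. As the second half starts next to
  where the first one ends, a translation by a nonzero distance yields a repetition, whereas a
  reflection identifies the letters of two distinct vertices at distance at most two, unless the
  two halves start at the same vertex.
\<close>

text \<open>Equal letters at distance one or two are the ends of a block of two or three letters,
  which is then a palindrome.\<close>

lemma palindrome_free_letters_distinct:
  assumes "\<not> has_palindrome T" "x < y" "y \<le> x + 2"
  shows "T x \<noteq> T y"
proof
  assume eq: "T x = T y"
  consider "y = x + 1" | "y = x + 2" using assms by linarith
  then have "\<exists>m\<ge>1. rev (block T x m) = block T x m"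
  proof cases
    case 1
    then show ?thesis using eq by (intro exI[of _ 1]) (simp add: block_def)
  next
    case 2
    then show ?thesis
      using eq by (intro exI[of _ 2]) (simp add: block_def numeral_2_eq_2)
  qed
  then show False using assms(1) by (auto simp: has_palindrome_def)
qed

lemma palindrome_free_near_inj:
  assumes "\<not> has_palindrome T" "T x = T y" "\<bar>x - y\<bar> \<le> 2"
  shows "x = y"
proof (rule ccontr)
  assume "x \<noteq> y"
  then consider "x < y" | "y < x" by linarith
  then show False
    using palindrome_free_letters_distinct[OF assms(1), of x y]
      palindrome_free_letters_distinct[OF assms(1), of y x] assms(2,3)
    by cases auto
qed

text \<open>The sign \<open>e\<close> is fixed by the first proper step of \<open>v\<close>; later
  steps are forced because the letters tell staying, turning back and going on apart.\<close>

lemma same_letters_imp_isometric: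
  fixes v u :: "nat \<Rightarrow> int"
  assumes pf: "\<not> has_palindrome T"
    and v: "\<And>i. i < n \<Longrightarrow> \<bar>v (Suc i) - v i\<bar> \<le> 1"
    and u: "\<And>i. i < n \<Longrightarrow> \<bar>u (Suc i) - u i\<bar> \<le> 1"
    and T: "\<And>i. i \<le> n \<Longrightarrow> T (v i) = T (u i)"
  shows "\<exists>e\<in>{1, -1}. \<forall>j\<le>n. u j - u 0 = e * (v j - v 0)"
proof -
  \<comment> \<open>A visited neighbour of the current vertex fixes the direction of the next step.\<close>
  have "(\<exists>e\<in>{1, -1}. \<forall>j\<le>m. u j - u 0 = e * (v j - v 0))
      \<and> ((\<forall>j\<le>m. v j = v 0) \<or> (\<exists>j<m. \<bar>v j - v m\<bar> = 1))"
    if "m \<le> n" for m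
    using that
  proof (induction m)
    case 0
    then show ?case by auto
  next
    case (Suc m)
    then have m: "m < n" by simp
    from Suc.IH[OF less_imp_le[OF m]] obtain e where e: "e = 1 \<or> e = -1"
      and iso: "\<And>j. j \<le> m \<Longrightarrow> u j - u 0 = e * (v j - v 0)"
      and nb: "(\<forall>j\<le>m. v j = v 0) \<or> (\<exists>j<m. \<bar>v j - v m\<bar> = 1)"
      by blast
    have near: "x = y \<longleftrightarrow> T x = T y" if "\<bar>x - y\<bar> \<le> 2" for x y
      using palindrome_free_near_inj[OF pf _ that] by blast
    have steps: "\<bar>v (Suc m) - v m\<bar> \<le> 1" "\<bar>u (Suc m) - u m\<bar> \<le> 1"
      using v u m by auto
    have Tm: "T (v m) = T (u m)" "T (v (Suc m)) = T (u (Suc m))"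
      using T m by auto
    \<comment> \<open>Near the next vertices, meeting a given vertex can be read off its letter, and
      both walks read the same letter next.\<close>
    have sync: "v (Suc m) = a \<longleftrightarrow> u (Suc m) = b"
      if "\<bar>v (Suc m) - a\<bar> \<le> 2" "\<bar>u (Suc m) - b\<bar> \<le> 2" "T a = T b" for a b
      using near[OF that(1)] near[OF that(2)] that(3) Tm(2) by simp
    have lazy: "v (Suc m) = v m \<longleftrightarrow> u (Suc m) = u m"
      by (rule sync) (use steps in linarith, use steps in linarith, rule Tm(1))
    \<comment> \<open>A pause keeps the old alternative; after a proper step the vertex just left is
      a visited neighbour.\<close>
    have nb': "(\<forall>j\<le>Suc m. v j = v 0) \<or> (\<exists>j<Suc m. \<bar>v j - v (Suc m)\<bar> = 1)"
    proof (cases "v (Suc m) = v m")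
      case True
      then show ?thesis using nb by (metis le_Suc_eq less_SucI order_refl)
    next
      case False
      then have "\<bar>v m - v (Suc m)\<bar> = 1" using steps by linarith
      then show ?thesis by blast
    qed
    have extend: "\<exists>e\<in>{1, -1}. \<forall>j\<le>Suc m. u j - u 0 = e * (v j - v 0)"
      if "e' = 1 \<or> e' = -1" "u (Suc m) - u 0 = e' * (v (Suc m) - v 0)"
        "\<And>j. j \<le> m \<Longrightarrow> u j - u 0 = e' * (v j - v 0)" for e'
    proof (intro bexI[of _ e'] allI impI)
      show "e' \<in> {1, -1}" using that(1) by simp
      fix j assume "j \<le> Suc m"
      then show "u j - u 0 = e' * (v j - v 0)" using that(2,3) by (cases "j = Suc m") simp_all
    qed
    have "\<exists>e\<in>{1, -1}. \<forall>j\<le>Suc m. u j - u 0 = e * (v j - v 0)"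
      using nb
    proof
      assume const: "\<forall>j\<le>m. v j = v 0"
      have cu: "u j = u 0" if "j \<le> m" for j
        using iso[OF that] const[rule_format, OF that] by simp
      have vm: "v m = v 0" using const by blast
      have um: "u m = u 0" using cu by blast
      \<comment> \<open>So far neither walk has moved, so every sign fits the past and can be chosen
        to suit this step.\<close>
      have "u (Suc m) - u 0 = v (Suc m) - v 0 \<or> u (Suc m) - u 0 = - (v (Suc m) - v 0)"
        using lazy steps unfolding vm um by linarith
      then obtain e' where "e' = 1 \<or> e' = -1" "u (Suc m) - u 0 = e' * (v (Suc m) - v 0)"
        by (metis mult_1 mult_minus1)
      then show ?thesis
      proof (rule extend)
        fix j assume "j \<le> m"
        then show "u j - u 0 = e' * (v j - v 0)" using cu[of j] const[rule_format, of j] by simp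
      qed
    next
      assume "\<exists>j<m. \<bar>v j - v m\<bar> = 1"
      then obtain j where j: "j < m" "\<bar>v j - v m\<bar> = 1" by blast
      have Tj: "T (v j) = T (u j)" using T j m by simp
      have uj: "u j - u m = e * (v j - v m)"
        using iso[of j] iso[of m] j by (simp add: algebra_simps)
      have uj1: "\<bar>u j - u m\<bar> = 1" using uj e j by auto
      \<comment> \<open>Together with \<open>lazy\<close> this settles the step: moving away from
        \<open>v j\<close> is the only option besides staying and returning.\<close>
      have ret: "v (Suc m) = v j \<longleftrightarrow> u (Suc m) = u j"
        by (rule sync) (use steps j(2) uj1 in linarith, use steps j(2) uj1 in linarith, rule Tj)
      have "u (Suc m) - u m = e * (v (Suc m) - v m)"
        using e
      proof
        assume e: "e = 1"
        have "u j - u m = v j - v m" using uj e by simp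
        then have "u (Suc m) - u m = v (Suc m) - v m" using lazy ret steps j(2) by linarith
        then show ?thesis using e by simp
      next
        assume e: "e = -1"
        have "u j - u m = v m - v j" using uj e by simp
        then have "u (Suc m) - u m = v m - v (Suc m)" using lazy ret steps j(2) by linarith
        then show ?thesis using e by simp
      qed
      then have "u (Suc m) - u 0 = e * (v (Suc m) - v 0)"
        using iso[of m] by (simp add: algebra_simps)
      with e show ?thesis by (rule extend) (rule iso)
    qed
    then show ?case using nb' by blast
  qed
  then show ?thesis by blast
qed

lemma lazy_walk_intermediate_value:
  fixes v :: "nat \<Rightarrow> int"
  assumes v: "\<And>i. i < n \<Longrightarrow> \<bar>v (Suc i) - v i\<bar> \<le> 1"
    and x: "min (v 0) (v n) \<le> x" "x \<le> max (v 0) (v n)"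
  shows "\<exists>j\<le>n. v j = x"
proof (cases "v 0 \<le> v n")
  case True
  then show ?thesis using nat_intermed_int_val[of 0 n v x] v x by auto
next
  \<comment> \<open>A descending walk becomes an ascending one by negation.\<close>
  case False
  have "\<exists>j\<ge>0. j \<le> n \<and> - v j = - x"
    by (rule nat_intermed_int_val) (use False v x in \<open>auto simp: abs_minus_commute\<close>)
  then show ?thesis by auto
qed

lemma repetition_shift:
  assumes "d \<noteq> 0" "\<And>x. l < x \<Longrightarrow> x \<le> l + \<bar>d\<bar> \<Longrightarrow> T x = T (x + d)"
  shows "has_repetition T"
proof -
  \<comment> \<open>The two equal blocks are the window after \<open>l\<close> and its translate by
    \<open>d\<close>; for negative \<open>d\<close> the translate comes first.\<close>
  define i where "i = l + 1 + min d 0"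
  have "T (i + int j) = T (i + int (nat \<bar>d\<bar>) + int j)" if "j < nat \<bar>d\<bar>" for j
  proof (cases "d > 0")
    case True
    then show ?thesis
      using assms(2)[of "l + 1 + int j"] that by (simp add: i_def algebra_simps)
  next
    case False
    then show ?thesis
      using assms(2)[of "l + 1 + int j"] that by (simp add: i_def algebra_simps)
  qed
  moreover have "nat \<bar>d\<bar> \<ge> 1" using assms(1) by linarith
  ultimately show ?thesis unfolding has_repetition_def by blast
qed

text \<open>The reflection \<open>c + a - x\<close> swaps \<open>a\<close> and \<open>c\<close>, and
  moves by at most two exactly the points within distance one of the midpoint. A non-fixed one of
  these lies on the side of \<open>a\<close>, and the path from \<open>a\<close> to \<open>b\<close>
  reaches it because \<open>b\<close> is next to or equal to \<open>c\<close>.\<close>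

lemma ex_near_reflection_centre:
  fixes a b c :: int
  assumes "\<bar>c - b\<bar> \<le> 1" "c \<noteq> a"
  shows "\<exists>x. min a b \<le> x \<and> x \<le> max a b \<and> c + a - x \<noteq> x \<and> \<bar>x - (c + a - x)\<bar> \<le> 2"
proof -
  \<comment> \<open>\<open>y\<close> is the last integer strictly below the midpoint. The first one
    strictly above is \<open>y + 1\<close> for odd \<open>a + c\<close>, and \<open>y + 2\<close>
    for even \<open>a + c\<close>, where \<open>y + 1\<close> is the fixed midpoint.\<close>
  define y where "y = (a + c - 1) div 2"
  have y: "2 * y = a + c - 1 \<or> 2 * y = a + c - 2" unfolding y_def by linarith
  consider "min a b \<le> y" "y \<le> max a b"
    | "min a b \<le> y + 1" "y + 1 \<le> max a b" "2 * y = a + c - 1"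
    | "min a b \<le> y + 2" "y + 2 \<le> max a b" "2 * y = a + c - 2"
    using y assms by linarith
  then show ?thesis
  proof cases
    case 1
    then show ?thesis using y by (intro exI[of _ y]) linarith
  next
    case 2
    then show ?thesis by (intro exI[of _ "y + 1"]) linarith
  next
    case 3
    then show ?thesis by (intro exI[of _ "y + 2"]) linarith
  qed
qed

lemma parallel_walks_same_start:
  fixes v u :: "nat \<Rightarrow> int"
  assumes thue: "palindrome_free_thue T"
    and v: "\<And>i. i < n \<Longrightarrow> \<bar>v (Suc i) - v i\<bar> \<le> 1"
    and u: "\<And>i. i < n \<Longrightarrow> \<bar>u (Suc i) - u i\<bar> \<le> 1"
    and T: "\<And>i. i \<le> n \<Longrightarrow> T (v i) = T (u i)"
    and join: "\<bar>u 0 - v n\<bar> \<le> 1"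
  shows "u 0 = v 0"
proof (rule ccontr)
  assume ne: "u 0 \<noteq> v 0"
  have pf: "\<not> has_palindrome T" and rf: "\<not> has_repetition T"
    using thue by (auto simp: palindrome_free_thue_def)
  obtain e where e: "e = 1 \<or> e = -1" and iso: "\<And>j. j \<le> n \<Longrightarrow> u j - u 0 = e * (v j - v 0)"
    using same_letters_imp_isometric[of T n v u, OF pf v u T] by blast
  \<comment> \<open>The first walk visits every vertex between its ends, so the agreement of letters
    passes from times to vertices.\<close>
  have Tx: "T x = T (u 0 + e * (x - v 0))"
    if x: "min (v 0) (v n) \<le> x" "x \<le> max (v 0) (v n)" for x
  proof -
    obtain j where j: "j \<le> n" "v j = x"
      using lazy_walk_intermediate_value[of n v x, OF v x] by blast
    then have "u j = u 0 + e * (x - v 0)" using iso[of j] by simp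
    then show ?thesis using T[of j] j by simp
  qed
  from e show False
  proof
    assume e: "e = 1"
    define d where "d = u 0 - v 0"
    \<comment> \<open>The window of \<open>\<bar>d\<bar>\<close> vertices starts at
      \<open>v 0\<close> and stops just before \<open>u 0\<close>, or runs from
      \<open>u 0 + 1\<close> up to \<open>v 0\<close> if \<open>d\<close> is negative. By
      \<open>join\<close> it lies between \<open>v 0\<close> and \<open>v n\<close>.\<close>
    define l where "l = v 0 - 1 + min 0 (d + 1)"
    have "has_repetition T"
    proof (rule repetition_shift[where d = d and l = l])
      show "d \<noteq> 0" using ne by (simp add: d_def)
      fix x assume "l < x" "x \<le> l + \<bar>d\<bar>"
      then have "min (v 0) (v n) \<le> x" "x \<le> max (v 0) (v n)"
        using join ne unfolding l_def d_def by linarith+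
      then show "T x = T (x + d)" using Tx e by (simp add: d_def algebra_simps)
    qed
    then show False using rf by simp
  next
    \<comment> \<open>Here \<open>v\<close> is carried to \<open>u\<close> by the reflection that
      swaps \<open>v 0\<close> and \<open>u 0\<close>.\<close>
    assume e: "e = -1"
    have "\<exists>x. min (v 0) (v n) \<le> x \<and> x \<le> max (v 0) (v n)
        \<and> u 0 + v 0 - x \<noteq> x \<and> \<bar>x - (u 0 + v 0 - x)\<bar> \<le> 2"
      using ex_near_reflection_centre[OF join ne] .
    then obtain x where x: "min (v 0) (v n) \<le> x" "x \<le> max (v 0) (v n)"
        "u 0 + v 0 - x \<noteq> x" "\<bar>x - (u 0 + v 0 - x)\<bar> \<le> 2" by blast
    have "T x = T (u 0 + v 0 - x)" using Tx[OF x(1,2)] e by (simp add: algebra_simps)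
    then show False using palindrome_free_near_inj[OF pf _ x(4)] x(3) by simp
  qed
qed

theorem theorem1:
  fixes T :: "int \<Rightarrow> letter" and W :: "int list" and k :: nat
  assumes "palindrome_free_thue T"
    and "lazy_walk W"
    and "repetitive T k W"
  shows "(\<forall>i<k. W ! i = W ! (k + i)) \<and> (\<exists>U. lazy_walk U \<and> length U = k \<and> W = U @ U)"
proof -
  have len: "length W = 2 * k" and rep: "\<And>i. i < k \<Longrightarrow> T (W ! i) = T (W ! (k + i))"
    using assms(3) by (auto simp: repetitive_def)
  have step: "\<bar>W ! Suc j - W ! j\<bar> \<le> 1" if "Suc j < 2 * k" for j
  proof -
    have "W ! Suc j - W ! j \<in> {-1, 0, 1}"
      using assms(2) len that by (simp add: lazy_walk_def)
    then show ?thesis by auto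
  qed
  have pf: "\<not> has_palindrome T" using assms(1) by (simp add: palindrome_free_thue_def)
  have eq: "W ! i = W ! (k + i)" if "i < k" for i
    using that
  proof (induction i)
    \<comment> \<open>A half with \<open>k\<close> vertices has \<open>k - 1\<close> steps; the step
      of \<open>W\<close> from position \<open>k - 1\<close> to \<open>k\<close> joins the
      halves.\<close>
    case 0
    then have "W ! (k + 0) = W ! 0"
      using parallel_walks_same_start[OF assms(1), where n = "k - 1" and v = "(!) W"
          and u = "\<lambda>i. W ! (k + i)"] rep step[of "k - 1"] step by auto
    then show ?case by simp
  next
    case (Suc i)
    have "\<bar>W ! Suc i - W ! i\<bar> \<le> 1" "\<bar>W ! (k + Suc i) - W ! (k + i)\<bar> \<le> 1"
      using step[of i] step[of "k + i"] Suc.prems by auto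
    moreover have "W ! i = W ! (k + i)" using Suc by simp
    \<comment> \<open>From a common vertex, two single steps end at most two apart, where equal
      letters force equal vertices.\<close>
    ultimately have "\<bar>W ! Suc i - W ! (k + Suc i)\<bar> \<le> 2" by linarith
    then show ?case using palindrome_free_near_inj[OF pf rep[OF Suc.prems]] by simp
  qed
  have "W = take k W @ take k W"
    by (rule nth_equalityI) (use len eq in \<open>auto simp: nth_append eq\<close>)
  moreover have "lazy_walk (take k W)"
    using assms(2) len by (simp add: lazy_walk_def)
  ultimately show ?thesis using eq len by (intro conjI exI[of _ "take k W"]) auto
qed

end
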